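(* Let $\mathrm{ACP}_{\mathrm{rec}}$ be the theory ACP extended with guarded recursion (finite or infinite guarded recursive specifications), with derivability $\vdash$ in infinitary conditional equational logic, and let $\underline{\leftrightarrow}$ denote bisimulation equivalence on closed $\mathrm{ACP}_{\mathrm{rec}}$ terms. For all closed $\mathrm{ACP}_{\mathrm{rec}}$ terms $t$ and $t'$: if $t \mathrel{\underline{\leftrightarrow}} t'$, then $\mathrm{ACP}_{\mathrm{rec}} \vdash t = t'$. Here $\underline{\leftrightarrow}$ stands for the relation called bisimulation equivalence in the context.
   Context: **ACP.** Fix an arbitrary set $A$ of actions with $\delta \notin A$; put $A_\delta = A \cup \{\delta\}$. Fix an arbitrary commutative and associative function $\gamma : A_\delta \times A_\delta \to A_\delta$ with $\gamma(\delta,a) = \delta$ for all $a \in A_\delta$. The signature of ACP has: a constant $a$ for each $a \in A$; a constant $\delta$; binary operators $+$ (alternative composition), $\cdot$ (sequential composition), $\parallel$ (parallel composition), $\lfloor\!\lfloor$ (left merge), $\mid$ (communication merge); and a unary operator $\partial_H$ (encapsulation) for each $H \subseteq A$. Fix an infinite set $\mathcal{X}$ of variables. ACP terms are the terms over this signature with variables in $\mathcal{X}$. Precedence: $+$ binds weakest, $\cdot$ binds strongest. The axioms of ACP are the following equations, where $a,b$ range over the constants of ACP (i.e. over $A_\delta$), $H$ over subsets of $A$, and $x,y,z$ are variables: $x+y=y+x$; $(x+y)+z=x+(y+z)$; $x+x=x$; $(x+y)\cdot z=x\cdot z+y\cdot z$; $(x\cdot y)\cdot z=x\cdot(y\cdot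 z)$; $x+\delta=x$; $\delta\cdot x=\delta$; $\partial_H(a)=a$ if $a\notin H$; $\partial_H(a)=\delta$ if $a\in H$; $\partial_H(x+y)=\partial_H(x)+\partial_H(y)$; $\partial_H(x\cdot y)=\partial_H(x)\cdot\partial_H(y)$; $x\parallel y=x\lfloor\!\lfloor y+y\lfloor\!\lfloor x+x\mid y$; $a\lfloor\!\lfloor x=a\cdot x$; $a\cdot x\lfloor\!\lfloor y=a\cdot(x\parallel y)$; $(x+y)\lfloor\!\lfloor z=x\lfloor\!\lfloor z+y\lfloor\!\lfloor z$; $a\cdot x\mid b=(a\mid b)\cdot x$; $a\mid b\cdot x=(a\mid b)\cdot x$; $a\cdot x\mid b\cdot y=(a\mid b)\cdot(x\parallel y)$; $(x+y)\mid z=x\mid z+y\mid z$; $x\mid(y+z)=x\mid y+x\mid z$; $a\mid b=\gamma(a,b)$. **Guarded recursion.** An occurrence of a variable $X$ in a term $t$ is guarded if $t$ has a subterm of the form $a\cdot t'$ with $a\in A$ such that $t'$ contains this occurrence. A term is guarded if all occurrences of variables in it are guarded. A guarded recursive specification over ACP is a set $E=\{X_i=t_i\mid i\in I\}$, with $I$ a finite or infinite (possibly uncountable) set, the $X_i\in\mathcal{X}$ pairwise distinct, each $t_i$ an ACP term in which only variables from $\{X_j\mid j\in I\}$ occur, such that each $t_i$ either is a guarded ACP term or can be rewritten (in finitely many steps) to a guarded ACP term in which only variables from $\{X_j\mid j\in I\}$ occur, using the axioms of ACP in either direction and/or the equations $X_j=t_j$ with $j\in I$, $j\neq i$, from left to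 right. $\mathrm{vars}(E)$ is the set of variables occurring in $E$. **$\mathrm{ACP}_{\mathrm{rec}}$.** The signature of ACP is extended with a constant $\langle X|E\rangle$ for each guarded recursive specification $E$ over ACP and each $X\in\mathrm{vars}(E)$. For an ACP term $t$, $\langle t|E\rangle$ denotes $t$ with every occurrence of each $X\in\mathrm{vars}(E)$ replaced by $\langle X|E\rangle$. The axioms of $\mathrm{ACP}_{\mathrm{rec}}$ are those of ACP together with: RDP: $\langle X|E\rangle=\langle t|E\rangle$ whenever $X=t$ is in $E$; RSP: the conditional equation $E\Rightarrow X=\langle X|E\rangle$ (premises: all equations in $E$) for each $X\in\mathrm{vars}(E)$. $\mathrm{ACP}_{\mathrm{rec}}$ terms are terms over the extended signature (the constants $\langle X|E\rangle$ contain no free variables); closed terms contain no variables. **Derivability.** $\mathrm{ACP}_{\mathrm{rec}}\vdash t=t'$ means that $t=t'$ is derivable from the axioms of $\mathrm{ACP}_{\mathrm{rec}}$ in infinitary conditional equational logic: the set of derivable equations is the least set of equations between $\mathrm{ACP}_{\mathrm{rec}}$ terms that contains all substitution instances of the unconditional axioms, is closed under reflexivity, symmetry, transitivity and congruence for all operators, and contains the substitution instance under $\sigma$ of the conclusion of a conditional axiom whenever it contains the instances under $\sigma$ of all (possibly infinitely many) its premises. Derivation trees may be infinitely branching but have no infinite branches. **Operational semantics.** For each $a\in A$ there are a unary relation $t\xrightarrow{a}\sqrt{}$ (read: $t$ can perform $a$ and then terminate successfully; $\sqrt{}$ is just part of the notation for this unary relation) and a binary relation $t\xrightarrow{a}t'$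 on closed $\mathrm{ACP}_{\mathrm{rec}}$ terms, the least relations closed under the following rules ($a,b,c\in A$): - $a\xrightarrow{a}\sqrt{}$. - If $x\xrightarrow{a}\sqrt{}$ then $x+y\xrightarrow{a}\sqrt{}$ and $y+x\xrightarrow{a}\sqrt{}$; if $x\xrightarrow{a}x'$ then $x+y\xrightarrow{a}x'$ and $y+x\xrightarrow{a}x'$. - If $x\xrightarrow{a}\sqrt{}$ then $x\cdot y\xrightarrow{a}y$; if $x\xrightarrow{a}x'$ then $x\cdot y\xrightarrow{a}x'\cdot y$. - If $x\xrightarrow{a}\sqrt{}$ then $x\parallel y\xrightarrow{a}y$; if $y\xrightarrow{a}\sqrt{}$ then $x\parallel y\xrightarrow{a}x$; if $x\xrightarrow{a}x'$ then $x\parallel y\xrightarrow{a}x'\parallel y$; if $y\xrightarrow{a}y'$ then $x\parallel y\xrightarrow{a}x\parallel y'$. - If $\gamma(a,b)=c$, then for $\diamond$ being either $\parallel$ or $\mid$: if $x\xrightarrow{a}\sqrt{}$ and $y\xrightarrow{b}\sqrt{}$ then $x\diamond y\xrightarrow{c}\sqrt{}$; if $x\xrightarrow{a}\sqrt{}$ and $y\xrightarrow{b}y'$ then $x\diamond y\xrightarrow{c}y'$; if $x\xrightarrow{a}x'$ and $y\xrightarrow{b}\sqrt{}$ then $x\diamond y\xrightarrow{c}x'$; if $x\xrightarrow{a}x'$ and $y\xrightarrow{b}y'$ then $x\diamond y\xrightarrow{c}x'\parallel y'$. - If $x\xrightarrow{a}\sqrt{}$ then $x\lfloor\!\lfloor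 y\xrightarrow{a}y$; if $x\xrightarrow{a}x'$ then $x\lfloor\!\lfloor y\xrightarrow{a}x'\parallel y$. - If $a\notin H$: if $x\xrightarrow{a}\sqrt{}$ then $\partial_H(x)\xrightarrow{a}\sqrt{}$; if $x\xrightarrow{a}x'$ then $\partial_H(x)\xrightarrow{a}\partial_H(x')$. - If $X=t$ is in $E$: if $\langle t|E\rangle\xrightarrow{a}\sqrt{}$ then $\langle X|E\rangle\xrightarrow{a}\sqrt{}$; if $\langle t|E\rangle\xrightarrow{a}x'$ then $\langle X|E\rangle\xrightarrow{a}x'$. **Bisimulation equivalence.** A bisimulation is a binary relation $R$ on closed $\mathrm{ACP}_{\mathrm{rec}}$ terms such that whenever $R(t_1,t_2)$, for every $a \in A$: if $t_1\xrightarrow{a}t_1'$ then there is $t_2'$ with $t_2\xrightarrow{a}t_2'$ and $R(t_1',t_2')$; if $t_2\xrightarrow{a}t_2'$ then there is $t_1'$ with $t_1\xrightarrow{a}t_1'$ and $R(t_1',t_2')$; and $t_1\xrightarrow{a}\sqrt{}$ iff $t_2\xrightarrow{a}\sqrt{}$. Closed terms $t_1,t_2$ are bisimulation equivalent, written $t_1\mathrel{\underline{\leftrightarrow}} t_2$ (the symbol $\underline{\leftrightarrow}$ is just a name for this relation), if $R(t_1,t_2)$ for some bisimulation $R$. *)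

theory Defs
  imports Main
begin

section \<open>Syntax\<close>

text \<open>
  The type \<open>'a\<close> plays the role of the set of actions together with the inaction constant: the
  latter is a distinguished element \<open>\<delta>\<close> of \<open>'a\<close>, and the actions are the elements of
  \<open>- {\<delta>}\<close>. So there may be no actions at all, or any number of them. The type \<open>'x\<close> is the set
  of variables.
\<close>

datatype bop = Alt | Seq | Par | LMerge | CMerge

datatype ('a, 'x) acp =
    Var 'x
  | Const 'a
  | Bin bop "('a, 'x) acp" "('a, 'x) acp"
  | Encap "'a set" "('a, 'x) acp"

abbreviation alt :: "('a, 'x) acp \<Rightarrow> ('a, 'x) acp \<Rightarrow> ('a, 'x) acp" (infixl "\<oplus>" 65)
  where "s \<oplus> t \<equiv> Bin Alt s t"
abbreviation seq :: "('a, 'x) acp \<Rightarrow> ('a, 'x) acp \<Rightarrow> ('a, 'x) acp" (infixl "\<odot>" 70)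
  where "s \<odot> t \<equiv> Bin Seq s t"
abbreviation par :: "('a, 'x) acp \<Rightarrow> ('a, 'x) acp \<Rightarrow> ('a, 'x) acp" (infixl "\<parallel>" 67)
  where "s \<parallel> t \<equiv> Bin Par s t"
abbreviation left_merge :: "('a, 'x) acp \<Rightarrow> ('a, 'x) acp \<Rightarrow> ('a, 'x) acp" (infixl "\<parallel>\<^sub>L" 67)
  where "s \<parallel>\<^sub>L t \<equiv> Bin LMerge s t"
abbreviation comm_merge :: "('a, 'x) acp \<Rightarrow> ('a, 'x) acp \<Rightarrow> ('a, 'x) acp" (infixl "\<parallel>\<^sub>C" 67)
  where "s \<parallel>\<^sub>C t \<equiv> Bin CMerge s t"

primrec vars :: "('a, 'x) acp \<Rightarrow> 'x set" where
  "vars (Var X) = {X}"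
| "vars (Const a) = {}"
| "vars (Bin f s t) = vars s \<union> vars t"
| "vars (Encap H t) = vars t"

primrec subst :: "('x \<Rightarrow> ('a, 'x) acp) \<Rightarrow> ('a, 'x) acp \<Rightarrow> ('a, 'x) acp" where
  "subst \<sigma> (Var X) = \<sigma> X"
| "subst \<sigma> (Const a) = Const a"
| "subst \<sigma> (Bin f s t) = Bin f (subst \<sigma> s) (subst \<sigma> t)"
| "subst \<sigma> (Encap H t) = Encap H (subst \<sigma> t)"

text \<open>
  A recursive specification \<open>{X\<^sub>i = t\<^sub>i | i \<in> I}\<close> with pairwise distinct \<open>X\<^sub>i\<close> is a partial
  function from variables to terms; its domain is \<open>{X\<^sub>i | i \<in> I}\<close>. Since right-hand sides only
  contain variables from this domain, the domain is also the set of variables occurring in the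
  specification.
\<close>

type_synonym ('a, 'x) rec_spec = "'x \<Rightarrow> ('a, 'x) acp option"

text \<open>\<open>Rec X E\<close> is the constant \<open>\<langle>X|E\<rangle>\<close>.\<close>

datatype ('a, 'x) acprec =
    RVar 'x
  | RConst 'a
  | RBin bop "('a, 'x) acprec" "('a, 'x) acprec"
  | REncap "'a set" "('a, 'x) acprec"
  | Rec 'x "('a, 'x) rec_spec"

primrec rvars :: "('a, 'x) acprec \<Rightarrow> 'x set" where
  "rvars (RVar X) = {X}"
| "rvars (RConst a) = {}"
| "rvars (RBin f s t) = rvars s \<union> rvars t"
| "rvars (REncap H t) = rvars t"
| "rvars (Rec X E) = {}"

primrec inst :: "('x \<Rightarrow> ('a, 'x) acprec) \<Rightarrow> ('a, 'x) acp \<Rightarrow> ('a, 'x) acprec" where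
  "inst \<sigma> (Var X) = \<sigma> X"
| "inst \<sigma> (Const a) = RConst a"
| "inst \<sigma> (Bin f s t) = RBin f (inst \<sigma> s) (inst \<sigma> t)"
| "inst \<sigma> (Encap H t) = REncap H (inst \<sigma> t)"

text \<open>\<open>rec_inst E t\<close> is \<open>\<langle>t|E\<rangle>\<close>.\<close>

definition rec_inst :: "('a, 'x) rec_spec \<Rightarrow> ('a, 'x) acp \<Rightarrow> ('a, 'x) acprec" where
  "rec_inst E t = inst (\<lambda>X. if X \<in> dom E then Rec X E else RVar X) t"

text \<open>Occurrences of subterms are identified by lists of (zero-based) argument positions.\<close>

primrec args :: "('a, 'x) acp \<Rightarrow> ('a, 'x) acp list" where
  "args (Var X) = []"
| "args (Const a) = []"
| "args (Bin f s t) = [s, t]"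
| "args (Encap H t) = [t]"

primrec subterm_at :: "nat list \<Rightarrow> ('a, 'x) acp \<Rightarrow> ('a, 'x) acp option" where
  "subterm_at [] t = Some t"
| "subterm_at (i # p) t = (if i < length (args t) then subterm_at p (args t ! i) else None)"


section \<open>The theory\<close>

locale ACP =
  fixes \<delta> :: 'a
    and \<gamma> :: "'a \<Rightarrow> 'a \<Rightarrow> 'a"
  assumes \<gamma>_commute: "\<gamma> a b = \<gamma> b a"
    and \<gamma>_assoc: "\<gamma> (\<gamma> a b) c = \<gamma> a (\<gamma> b c)"
    and \<gamma>_\<delta>: "\<gamma> \<delta> a = \<delta>"
begin

abbreviation actions :: "'a set" where
  "actions \<equiv> - {\<delta>}"

primrec acp_term :: "('a, 'x) acp \<Rightarrow> bool" where
  "acp_term (Var X) \<longleftrightarrow> True"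
| "acp_term (Const a) \<longleftrightarrow> True"
| "acp_term (Bin f s t) \<longleftrightarrow> acp_term s \<and> acp_term t"
| "acp_term (Encap H t) \<longleftrightarrow> H \<subseteq> actions \<and> acp_term t"

inductive acp_axiom :: "('a, 'x) acp \<Rightarrow> ('a, 'x) acp \<Rightarrow> bool" where
  A1: "acp_axiom (Var x \<oplus> Var y) (Var y \<oplus> Var x)"
| A2: "acp_axiom ((Var x \<oplus> Var y) \<oplus> Var z) (Var x \<oplus> (Var y \<oplus> Var z))"
| A3: "acp_axiom (Var x \<oplus> Var x) (Var x)"
| A4: "acp_axiom ((Var x \<oplus> Var y) \<odot> Var z) (Var x \<odot> Var z \<oplus> Var y \<odot> Var z)"
| A5: "acp_axiom ((Var x \<odot> Var y) \<odot> Var z) (Var x \<odot> (Var y \<odot> Var z))"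
| A6: "acp_axiom (Var x \<oplus> Const \<delta>) (Var x)"
| A7: "acp_axiom (Const \<delta> \<odot> Var x) (Const \<delta>)"
| D1: "\<lbrakk>H \<subseteq> actions; a \<notin> H\<rbrakk> \<Longrightarrow> acp_axiom (Encap H (Const a)) (Const a)"
| D2: "\<lbrakk>H \<subseteq> actions; a \<in> H\<rbrakk> \<Longrightarrow> acp_axiom (Encap H (Const a)) (Const \<delta>)"
| D3: "H \<subseteq> actions \<Longrightarrow>
    acp_axiom (Encap H (Var x \<oplus> Var y)) (Encap H (Var x) \<oplus> Encap H (Var y))"
| D4: "H \<subseteq> actions \<Longrightarrow>
    acp_axiom (Encap H (Var x \<odot> Var y)) (Encap H (Var x) \<odot> Encap H (Var y))"
| CM1: "acp_axiom (Var x \<parallel> Var y) (Var x \<parallel>\<^sub>L Var y \<oplus> Var y \<parallel>\<^sub>L Var x \<oplus> Var x \<parallel>\<^sub>C Var y)"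
| CM2: "acp_axiom (Const a \<parallel>\<^sub>L Var x) (Const a \<odot> Var x)"
| CM3: "acp_axiom (Const a \<odot> Var x \<parallel>\<^sub>L Var y) (Const a \<odot> (Var x \<parallel> Var y))"
| CM4: "acp_axiom ((Var x \<oplus> Var y) \<parallel>\<^sub>L Var z) (Var x \<parallel>\<^sub>L Var z \<oplus> Var y \<parallel>\<^sub>L Var z)"
| CM5: "acp_axiom (Const a \<odot> Var x \<parallel>\<^sub>C Const b) ((Const a \<parallel>\<^sub>C Const b) \<odot> Var x)"
| CM6: "acp_axiom (Const a \<parallel>\<^sub>C Const b \<odot> Var x) ((Const a \<parallel>\<^sub>C Const b) \<odot> Var x)"
| CM7: "acp_axiom (Const a \<odot> Var x \<parallel>\<^sub>C Const b \<odot> Var y)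
    ((Const a \<parallel>\<^sub>C Const b) \<odot> (Var x \<parallel> Var y))"
| CM8: "acp_axiom ((Var x \<oplus> Var y) \<parallel>\<^sub>C Var z) (Var x \<parallel>\<^sub>C Var z \<oplus> Var y \<parallel>\<^sub>C Var z)"
| CM9: "acp_axiom (Var x \<parallel>\<^sub>C (Var y \<oplus> Var z)) (Var x \<parallel>\<^sub>C Var y \<oplus> Var x \<parallel>\<^sub>C Var z)"
| CF: "acp_axiom (Const a \<parallel>\<^sub>C Const b) (Const (\<gamma> a b))"


section \<open>Guarded recursive specifications\<close>

text \<open>
  The occurrence at position \<open>p\<close> lies inside the second argument (index \<open>1\<close>) of a subterm
  \<open>Const a \<odot> t'\<close>, which itself is at position \<open>q\<close>.
\<close>

definition guarded_occ :: "('a, 'x) acp \<Rightarrow> nat list \<Rightarrow> bool" where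
  "guarded_occ t p \<longleftrightarrow>
    (\<exists>q r a t'. p = q @ 1 # r \<and> a \<in> actions \<and> subterm_at q t = Some (Const a \<odot> t'))"

definition guarded :: "('a, 'x) acp \<Rightarrow> bool" where
  "guarded t \<longleftrightarrow> (\<forall>p X. subterm_at p t = Some (Var X) \<longrightarrow> guarded_occ t p)"

text \<open>
  \<open>rewrite E X\<close> is a single rewrite step that may be used for the right-hand side of the equation
  for \<open>X\<close> in \<open>E\<close>.
\<close>

inductive rewrite :: "('a, 'x) rec_spec \<Rightarrow> 'x \<Rightarrow> ('a, 'x) acp \<Rightarrow> ('a, 'x) acp \<Rightarrow> bool"
  for E X where
  axiom_lr: "\<lbrakk>acp_axiom l r; \<And>Y. acp_term (\<sigma> Y)\<rbrakk> \<Longrightarrow> rewrite E X (subst \<sigma> l) (subst \<sigma> r)"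
| axiom_rl: "\<lbrakk>acp_axiom l r; \<And>Y. acp_term (\<sigma> Y)\<rbrakk> \<Longrightarrow> rewrite E X (subst \<sigma> r) (subst \<sigma> l)"
| unfold: "\<lbrakk>E Y = Some t; Y \<noteq> X\<rbrakk> \<Longrightarrow> rewrite E X (Var Y) t"
| bin_left: "rewrite E X s s' \<Longrightarrow> rewrite E X (Bin f s t) (Bin f s' t)"
| bin_right: "rewrite E X t t' \<Longrightarrow> rewrite E X (Bin f s t) (Bin f s t')"
| encap: "rewrite E X t t' \<Longrightarrow> rewrite E X (Encap H t) (Encap H t')"

definition guarded_spec :: "('a, 'x) rec_spec \<Rightarrow> bool" where
  "guarded_spec E \<longleftrightarrow>
    (\<forall>X t. E X = Some t \<longrightarrow>
      acp_term t \<and> vars t \<subseteq> dom E \<and>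
      (\<exists>t'. (rewrite E X)\<^sup>*\<^sup>* t t' \<and> acp_term t' \<and> vars t' \<subseteq> dom E \<and> guarded t'))"


section \<open>Terms with recursion and derivability\<close>

primrec acprec_term :: "('a, 'x) acprec \<Rightarrow> bool" where
  "acprec_term (RVar X) \<longleftrightarrow> True"
| "acprec_term (RConst a) \<longleftrightarrow> True"
| "acprec_term (RBin f s t) \<longleftrightarrow> acprec_term s \<and> acprec_term t"
| "acprec_term (REncap H t) \<longleftrightarrow> H \<subseteq> actions \<and> acprec_term t"
| "acprec_term (Rec X E) \<longleftrightarrow> guarded_spec E \<and> X \<in> dom E"

definition closed_term :: "('a, 'x) acprec \<Rightarrow> bool" where
  "closed_term t \<longleftrightarrow> acprec_term t \<and> rvars t = {}"

inductive derivable :: "('a, 'x) acprec \<Rightarrow> ('a, 'x) acprec \<Rightarrow> bool" where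
  ax: "\<lbrakk>acp_axiom l r; \<And>Y. acprec_term (\<sigma> Y)\<rbrakk> \<Longrightarrow> derivable (inst \<sigma> l) (inst \<sigma> r)"
| RDP: "\<lbrakk>guarded_spec E; E X = Some t\<rbrakk> \<Longrightarrow> derivable (Rec X E) (rec_inst E t)"
| RSP: "\<lbrakk>guarded_spec E; X \<in> dom E; \<And>Y. acprec_term (\<sigma> Y);
    \<And>Y t. E Y = Some t \<Longrightarrow> derivable (\<sigma> Y) (inst \<sigma> t)\<rbrakk> \<Longrightarrow> derivable (\<sigma> X) (Rec X E)"
| refl: "acprec_term t \<Longrightarrow> derivable t t"
| sym: "derivable s t \<Longrightarrow> derivable t s"
| trans: "\<lbrakk>derivable s t; derivable t u\<rbrakk> \<Longrightarrow> derivable s u"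
| cong_bin: "\<lbrakk>derivable s s'; derivable t t'\<rbrakk> \<Longrightarrow> derivable (RBin f s t) (RBin f s' t')"
| cong_encap: "\<lbrakk>H \<subseteq> actions; derivable t t'\<rbrakk> \<Longrightarrow> derivable (REncap H t) (REncap H t')"


section \<open>Operational semantics and bisimulation equivalence\<close>

text \<open>
  The rules are stated without side conditions saying that terms are closed; by the lemmas below,
  derivations of transitions of closed terms only involve closed terms.
\<close>

inductive term_step :: "('a, 'x) acprec \<Rightarrow> 'a \<Rightarrow> bool" where
  "a \<in> actions \<Longrightarrow> term_step (RConst a) a"
| "term_step x a \<Longrightarrow> term_step (RBin Alt x y) a"
| "term_step x a \<Longrightarrow> term_step (RBin Alt y x) a"
| "\<lbrakk>f \<in> {Par, CMerge}; \<gamma> a b = c; c \<in> actions; term_step x a; term_step y b\<rbrakk> \<Longrightarrow>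
    term_step (RBin f x y) c"
| "\<lbrakk>a \<notin> H; term_step x a\<rbrakk> \<Longrightarrow> term_step (REncap H x) a"
| "\<lbrakk>E X = Some t; term_step (rec_inst E t) a\<rbrakk> \<Longrightarrow> term_step (Rec X E) a"

inductive step :: "('a, 'x) acprec \<Rightarrow> 'a \<Rightarrow> ('a, 'x) acprec \<Rightarrow> bool" where
  "step x a x' \<Longrightarrow> step (RBin Alt x y) a x'"
| "step x a x' \<Longrightarrow> step (RBin Alt y x) a x'"
| "term_step x a \<Longrightarrow> step (RBin Seq x y) a y"
| "step x a x' \<Longrightarrow> step (RBin Seq x y) a (RBin Seq x' y)"
| "term_step x a \<Longrightarrow> step (RBin Par x y) a y"
| "term_step y a \<Longrightarrow> step (RBin Par x y) a x"
| "step x a x' \<Longrightarrow> step (RBin Par x y) a (RBin Par x' y)"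
| "step y a y' \<Longrightarrow> step (RBin Par x y) a (RBin Par x y')"
| "\<lbrakk>f \<in> {Par, CMerge}; \<gamma> a b = c; c \<in> actions; term_step x a; step y b y'\<rbrakk> \<Longrightarrow>
    step (RBin f x y) c y'"
| "\<lbrakk>f \<in> {Par, CMerge}; \<gamma> a b = c; c \<in> actions; step x a x'; term_step y b\<rbrakk> \<Longrightarrow>
    step (RBin f x y) c x'"
| "\<lbrakk>f \<in> {Par, CMerge}; \<gamma> a b = c; c \<in> actions; step x a x'; step y b y'\<rbrakk> \<Longrightarrow>
    step (RBin f x y) c (RBin Par x' y')"
| "term_step x a \<Longrightarrow> step (RBin LMerge x y) a y"
| "step x a x' \<Longrightarrow> step (RBin LMerge x y) a (RBin Par x' y)"
| "\<lbrakk>a \<notin> H; step x a x'\<rbrakk> \<Longrightarrow> step (REncap H x) a (REncap H x')"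
| "\<lbrakk>E X = Some t; step (rec_inst E t) a x'\<rbrakk> \<Longrightarrow> step (Rec X E) a x'"

definition bisimulation :: "(('a, 'x) acprec \<Rightarrow> ('a, 'x) acprec \<Rightarrow> bool) \<Rightarrow> bool" where
  "bisimulation R \<longleftrightarrow>
    (\<forall>t1 t2. R t1 t2 \<longrightarrow>
      closed_term t1 \<and> closed_term t2 \<and>
      (\<forall>a \<in> actions.
        (\<forall>t1'. step t1 a t1' \<longrightarrow> (\<exists>t2'. step t2 a t2' \<and> R t1' t2')) \<and>
        (\<forall>t2'. step t2 a t2' \<longrightarrow> (\<exists>t1'. step t1 a t1' \<and> R t1' t2')) \<and>
        (term_step t1 a \<longleftrightarrow> term_step t2 a)))"

definition bisimilar :: "('a, 'x) acprec \<Rightarrow> ('a, 'x) acprec \<Rightarrow> bool" where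
  "bisimilar t1 t2 \<longleftrightarrow> (\<exists>R. bisimulation R \<and> R t1 t2)"

lemma term_step_action: "term_step t a \<Longrightarrow> a \<in> actions"
  by (induction rule: term_step.induct) auto

lemma step_action: "step t a t' \<Longrightarrow> a \<in> actions"
  by (induction rule: step.induct) (auto dest: term_step_action)

lemma closed_inst:
  assumes "acp_term t" "\<And>X. X \<in> vars t \<Longrightarrow> closed_term (\<sigma> X)"
  shows "closed_term (inst \<sigma> t)"
  using assms by (induction t) (auto simp: closed_term_def)

lemma closed_rec_inst:
  assumes "guarded_spec E" "E X = Some t"
  shows "closed_term (rec_inst E t)"
proof -
  have "acp_term t" "vars t \<subseteq> dom E"
    using assms unfolding guarded_spec_def by blast+
  with assms(1) show ?thesis
    unfolding rec_inst_def by (intro closed_inst) (auto simp: closed_term_def)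
qed

lemma closed_step: "step t a t' \<Longrightarrow> closed_term t \<Longrightarrow> closed_term t'"
proof (induction rule: step.induct)
  case (15 E X t a x')
  then show ?case
    using closed_rec_inst[of E X t] by (auto simp: closed_term_def)
qed (auto simp: closed_term_def)

end

end

theory Submission
  imports Defs "HOL-Library.Countable_Set"
begin

text \<open>
  By guardedness, every closed term is provably equal to a finite sum of actions and prefixes
  \<open>a \<cdot> s\<close>; only the ACP axioms and RDP are needed for this, and these are sound, so the summands
  match the transitions up to bisimilarity. Starting from bisimilar \<open>t\<close> and \<open>t'\<close>, repeatedly pair
  each prefix \<open>a \<cdot> v\<close> of one side with the prefixes \<open>a \<cdot> v'\<close> of the other for which \<open>v\<close> and \<open>v'\<close>
  are bisimilar. The sums being finite, only countably many pairs are reached, so they can be encoded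
  by variables. The linear specification with one equation per pair is solved both by the first and by
  the second components, and RSP applied twice gives the claim.
\<close>

context ACP
begin

lemma \<gamma>_\<delta>_right: "\<gamma> a \<delta> = \<delta>"
  using \<gamma>_commute \<gamma>_\<delta> by metis

subsection \<open>Soundness of the unconditional axioms\<close>

text \<open>
  Commutativity of parallel composition is included because the axiom \<open>CM1\<close> is sound only up to
  it: after a step of \<open>y\<close>, the left-hand side is \<open>x \<parallel> y'\<close> and the right-hand side is \<open>y' \<parallel> x\<close>.
  The rules \<open>seq_assoc\<close> and \<open>encap_seq\<close> are needed because an instance of \<open>A5\<close> or \<open>D4\<close> in which
  variables coincide does not have residuals of the same form.
\<close>

inductive eqv :: "('a, 'x) acprec \<Rightarrow> ('a, 'x) acprec \<Rightarrow> bool" where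
  ax: "acp_axiom l r \<Longrightarrow> eqv (inst \<sigma> l) (inst \<sigma> r)"
| par_commute: "eqv (RBin Par s t) (RBin Par t s)"
| seq_assoc: "eqv (RBin Seq (RBin Seq s t) u) (RBin Seq s (RBin Seq t u))"
| encap_seq: "eqv (REncap H (RBin Seq s t)) (RBin Seq (REncap H s) (REncap H t))"
| RDP: "E X = Some t \<Longrightarrow> eqv (Rec X E) (rec_inst E t)"
| refl: "eqv t t"
| sym: "eqv s t \<Longrightarrow> eqv t s"
| trans: "\<lbrakk>eqv s t; eqv t u\<rbrakk> \<Longrightarrow> eqv s u"
| cong_bin: "\<lbrakk>eqv s s'; eqv t t'\<rbrakk> \<Longrightarrow> eqv (RBin f s t) (RBin f s' t')"
| cong_encap: "eqv t t' \<Longrightarrow> eqv (REncap H t) (REncap H t')"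

lemma term_step_simps [simp]:
  "term_step (RVar X) a \<longleftrightarrow> False"
  "term_step (RConst b) a \<longleftrightarrow> a = b \<and> a \<noteq> \<delta>"
  "term_step (RBin Alt x y) a \<longleftrightarrow> term_step x a \<or> term_step y a"
  "term_step (RBin Seq x y) a \<longleftrightarrow> False"
  "term_step (RBin LMerge x y) a \<longleftrightarrow> False"
  "term_step (RBin Par x y) a \<longleftrightarrow>
    (\<exists>b c. \<gamma> b c = a \<and> a \<noteq> \<delta> \<and> term_step x b \<and> term_step y c)"
  "term_step (RBin CMerge x y) a \<longleftrightarrow>
    (\<exists>b c. \<gamma> b c = a \<and> a \<noteq> \<delta> \<and> term_step x b \<and> term_step y c)"
  "term_step (REncap H x) a \<longleftrightarrow> a \<notin> H \<and> term_step x a"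
  "term_step (Rec X E) a \<longleftrightarrow> (\<exists>t. E X = Some t \<and> term_step (rec_inst E t) a)"
  by (subst term_step.simps; auto)+

lemma step_simps [simp]:
  "step (RVar X) a z \<longleftrightarrow> False"
  "step (RConst b) a z \<longleftrightarrow> False"
  "step (RBin Alt x y) a z \<longleftrightarrow> step x a z \<or> step y a z"
  "step (RBin Seq x y) a z \<longleftrightarrow>
    term_step x a \<and> z = y \<or> (\<exists>x'. step x a x' \<and> z = RBin Seq x' y)"
  "step (RBin LMerge x y) a z \<longleftrightarrow>
    term_step x a \<and> z = y \<or> (\<exists>x'. step x a x' \<and> z = RBin Par x' y)"
  "step (RBin CMerge x y) a z \<longleftrightarrow>
    (\<exists>b c. \<gamma> b c = a \<and> a \<noteq> \<delta> \<and>
      (term_step x b \<and> step y c z \<or> step x b z \<and> term_step y c \<or>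
       (\<exists>x' y'. step x b x' \<and> step y c y' \<and> z = RBin Par x' y')))"
  "step (RBin Par x y) a z \<longleftrightarrow>
    term_step x a \<and> z = y \<or> (\<exists>x'. step x a x' \<and> z = RBin Par x' y) \<or>
    term_step y a \<and> z = x \<or> (\<exists>y'. step y a y' \<and> z = RBin Par x y') \<or>
    (\<exists>b c. \<gamma> b c = a \<and> a \<noteq> \<delta> \<and>
      (term_step x b \<and> step y c z \<or> step x b z \<and> term_step y c \<or>
       (\<exists>x' y'. step x b x' \<and> step y c y' \<and> z = RBin Par x' y')))"
  "step (REncap H x) a z \<longleftrightarrow> a \<notin> H \<and> (\<exists>x'. step x a x' \<and> z = REncap H x')"
  "step (Rec X E) a z \<longleftrightarrow> (\<exists>t. E X = Some t \<and> step (rec_inst E t) a z)"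
  by (subst step.simps; auto; fail)+

text \<open>Only one half of the transfer conditions of a bisimulation, so that the symmetry rule of
  \<open>eqv\<close> merely swaps the two halves. Residuals are compared by \<open>eqv\<close>
  itself.\<close>

definition transfers :: "('a, 'x) acprec \<Rightarrow> ('a, 'x) acprec \<Rightarrow> bool" where
  "transfers s t \<longleftrightarrow>
    (\<forall>a. term_step s a \<longrightarrow> term_step t a) \<and>
    (\<forall>a s'. step s a s' \<longrightarrow> (\<exists>t'. step t a t' \<and> eqv s' t'))"

text \<open>Settles every axiom except \<open>A5\<close>, \<open>D4\<close> and \<open>CM1\<close>:
  in all the others both sides have literally the same residuals.\<close>

lemma transfers_same_steps:
  assumes "\<And>a. term_step s a \<longleftrightarrow> term_step t a" "\<And>a z. step s a z \<longleftrightarrow> step t a z"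
  shows "transfers s t \<and> transfers t s"
  using assms unfolding transfers_def by (blast intro: eqv.refl)

text \<open>Splits the steps of a merge along the three summands of \<open>CM1\<close>. The middle
  one is spelled out because its residuals have the operands of the merge exchanged.\<close>

lemma step_Par: "step (RBin Par x y) a z \<longleftrightarrow>
    step (RBin LMerge x y) a z \<or> term_step y a \<and> z = x \<or>
    (\<exists>y'. step y a y' \<and> z = RBin Par x y') \<or> step (RBin CMerge x y) a z"
  by auto

lemma ex_image: "(\<exists>z. (\<exists>x. P x \<and> z = f x) \<and> Q z) \<longleftrightarrow> (\<exists>x. P x \<and> Q (f x))"
  by blast

lemma transfers_axiom:
  assumes "acp_axiom l r"
  shows "transfers (inst \<sigma> l) (inst \<sigma> r) \<and> transfers (inst \<sigma> r) (inst \<sigma> l)"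
  using assms
proof cases
  case (A5 x y z)
  then show ?thesis
    by (auto simp: transfers_def ex_image ex_disj_distrib conj_disj_distribR eqv.refl
        intro: eqv.seq_assoc eqv.seq_assoc[THEN eqv.sym])
next
  case (D4 H x y)
  then show ?thesis
    by (auto simp: transfers_def ex_image ex_disj_distrib conj_disj_distribR eqv.refl
        intro: eqv.encap_seq eqv.encap_seq[THEN eqv.sym])
next
  case (CM1 x y)
  then show ?thesis
    by (auto simp: transfers_def step_Par ex_image ex_disj_distrib conj_disj_distribR
        eqv.refl eqv.par_commute simp del: step_simps(6,7) intro: eqv.refl)
qed (rule transfers_same_steps; auto simp: \<gamma>_\<delta> \<gamma>_\<delta>_right)+

text \<open>The \<open>eqv\<close> hypotheses enter through residuals that retain an operand which
  has not moved, such as the second factor of a sequential composition.\<close>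

lemma transfers_bin:
  assumes "transfers s s'" "transfers t t'" "eqv s s'" "eqv t t'"
  shows "transfers (RBin f s t) (RBin f s' t')"
proof -
  have terms: "term_step s a \<Longrightarrow> term_step s' a" "term_step t a \<Longrightarrow> term_step t' a" for a
    using assms(1,2) unfolding transfers_def by blast+
  have steps: "step s a u \<Longrightarrow> \<exists>v. step s' a v \<and> eqv u v"
    "step t a u \<Longrightarrow> \<exists>v. step t' a v \<and> eqv u v" for a u
    using assms(1,2) unfolding transfers_def by blast+
  have "term_step (RBin f s' t') a" if "term_step (RBin f s t) a" for a
    using that terms by (cases f) auto
  moreover have "\<exists>v. step (RBin f s' t') a v \<and> eqv u v" if "step (RBin f s t) a u" for a u
    using that
    by cases (metis terms steps assms(3,4) step.intros eqv.cong_bin)+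
  ultimately show ?thesis
    unfolding transfers_def by blast
qed

text \<open>Thus \<open>eqv\<close> meets the transfer conditions of a bisimulation, which is the
  soundness of the ACP axioms and \<open>RDP\<close>. Both halves go through one induction because
  of the symmetry rule.\<close>

lemma eqv_transfers: "eqv s t \<Longrightarrow> transfers s t \<and> transfers t s"
proof (induction rule: eqv.induct)
  case (ax l r \<sigma>)
  then show ?case by (simp add: transfers_axiom)
next
  case (par_commute s t)
  have "transfers (RBin Par s t) (RBin Par t s)" for s t :: "('a, 'x) acprec"
    by (auto simp: transfers_def ex_disj_distrib conj_disj_distribR)
      (metis \<gamma>_commute eqv.refl eqv.par_commute)+
  then show ?case by blast
next
  case (RDP E X t)
  then show ?case by (auto simp: transfers_def intro: eqv.refl)
next
  case (trans s t u)
  then show ?case unfolding transfers_def by (meson eqv.trans)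
next
  case (cong_bin s s' t t' f)
  then show ?case by (simp add: transfers_bin eqv.sym)
next
  case (cong_encap t t' H)
  then show ?case by (auto simp: transfers_def) (blast intro: eqv.cong_encap)+
qed (auto simp: transfers_def
    intro: eqv.refl eqv.seq_assoc eqv.encap_seq eqv.seq_assoc[THEN eqv.sym] eqv.encap_seq[THEN eqv.sym])

lemma eqv_term_step: "eqv s t \<Longrightarrow> term_step s a \<longleftrightarrow> term_step t a"
  using eqv_transfers unfolding transfers_def by blast

lemma eqv_step: "eqv s t \<Longrightarrow> step s a u \<Longrightarrow> \<exists>v. step t a v \<and> eqv u v"
  using eqv_transfers unfolding transfers_def by blast

subsection \<open>Provable and sound equality\<close>

lemma acprec_term_inst:
  "acp_term t \<Longrightarrow> (\<And>Y. Y \<in> vars t \<Longrightarrow> acprec_term (\<sigma> Y)) \<Longrightarrow> acprec_term (inst \<sigma> t)"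
  by (induction t) auto

lemma acp_axiom_terms: "acp_axiom l r \<Longrightarrow> acp_term l \<and> acp_term r"
  by (induction rule: acp_axiom.induct) auto

lemma derivable_terms: "derivable s t \<Longrightarrow> acprec_term s \<and> acprec_term t"
proof (induction rule: derivable.induct)
  case (RDP E X t)
  then show ?case
    using closed_rec_inst[of E X t] by (auto simp: closed_term_def)
qed (auto dest: acp_axiom_terms intro: acprec_term_inst)

lemma inst_subst: "inst \<tau> (subst \<sigma> t) = inst (\<lambda>Y. inst \<tau> (\<sigma> Y)) t"
  by (induction t) auto

lemma acp_term_subst: "acp_term t \<Longrightarrow> (\<And>Y. acp_term (\<sigma> Y)) \<Longrightarrow> acp_term (subst \<sigma> t)"
  by (induction t) auto

lemma acprec_term_rec_inst: "guarded_spec E \<Longrightarrow> acp_term t \<Longrightarrow> acprec_term (rec_inst E t)"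
  unfolding rec_inst_def by (rule acprec_term_inst) auto

text \<open>A guard of a variable in an operand can lie outside that operand only at the root, and
  there only if the whole term is a prefix \<open>Const a \<odot> t\<close>, which the second
  assumption excludes.\<close>

lemma guarded_bin:
  assumes "guarded (Bin f s t)" "\<And>a. a \<in> actions \<Longrightarrow> Bin f s t \<noteq> Const a \<odot> t"
  shows "guarded s" "guarded t"
proof -
  have "guarded_occ s p" if "subterm_at p s = Some (Var V)" for p V
  proof -
    have "guarded_occ (Bin f s t) (0 # p)"
      using assms(1) that unfolding guarded_def by force
    then obtain q r a t' where "0 # p = q @ 1 # r" "a \<in> actions"
      "subterm_at q (Bin f s t) = Some (Const a \<odot> t')"
      unfolding guarded_occ_def by blast
    then show ?thesis
      unfolding guarded_occ_def by (cases q) auto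
  qed
  then show "guarded s"
    unfolding guarded_def by blast
  have "guarded_occ t p" if "subterm_at p t = Some (Var V)" for p V
  proof -
    have "guarded_occ (Bin f s t) (1 # p)"
      using assms(1) that unfolding guarded_def by force
    then obtain q r a t' where "1 # p = q @ 1 # r" "a \<in> actions"
      "subterm_at q (Bin f s t) = Some (Const a \<odot> t')"
      unfolding guarded_occ_def by blast
    then show ?thesis
      using assms(2) unfolding guarded_occ_def by (cases q) auto
  qed
  then show "guarded t"
    unfolding guarded_def by blast
qed

lemma guarded_encap:
  assumes "guarded (Encap H t)"
  shows "guarded t"
  unfolding guarded_def
proof (intro allI impI)
  fix p V
  assume "subterm_at p t = Some (Var V)"
  then have "guarded_occ (Encap H t) (0 # p)"
    using assms unfolding guarded_def by force
  then obtain q r a t' where "0 # p = q @ 1 # r" "a \<in> actions"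
    "subterm_at q (Encap H t) = Some (Const a \<odot> t')"
    unfolding guarded_occ_def by blast
  then show "guarded_occ t p"
    unfolding guarded_occ_def by (cases q) auto
qed

text \<open>
  Substituting terms independently into an axiom takes up to three distinct variables.
\<close>

context
  fixes X Y Z :: 'x
  assumes distinct [simp]: "X \<noteq> Y" "X \<noteq> Z" "Y \<noteq> Z"
begin

text \<open>Both components are closed under the same rules, so one chain of
  \<open>\<approx>\<close> steps yields a provable equation and at the same time a match between the
  transitions of its sides.\<close>

definition peq :: "('a, 'x) acprec \<Rightarrow> ('a, 'x) acprec \<Rightarrow> bool" (infix "\<approx>" 50) where
  "s \<approx> t \<longleftrightarrow> derivable s t \<and> eqv s t"

lemma peq_terms:
  assumes "s \<approx> t"
  shows "acprec_term s" "acprec_term t"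
  using assms derivable_terms unfolding peq_def by blast+

lemma peq_axiom: "acp_axiom l r \<Longrightarrow> (\<And>Y. acprec_term (\<sigma> Y)) \<Longrightarrow> inst \<sigma> l \<approx> inst \<sigma> r"
  unfolding peq_def by (blast intro: derivable.ax eqv.ax)

lemma peq_RDP: "guarded_spec E \<Longrightarrow> E V = Some t \<Longrightarrow> Rec V E \<approx> rec_inst E t"
  unfolding peq_def by (blast intro: derivable.RDP eqv.RDP)

lemma peq_refl: "acprec_term t \<Longrightarrow> t \<approx> t"
  unfolding peq_def by (blast intro: derivable.refl eqv.refl)

lemma peq_sym: "s \<approx> t \<Longrightarrow> t \<approx> s"
  unfolding peq_def by (blast intro: derivable.sym eqv.sym)

lemma peq_trans [trans]: "s \<approx> t \<Longrightarrow> t \<approx> u \<Longrightarrow> s \<approx> u"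
  unfolding peq_def by (blast intro: derivable.trans eqv.trans)

lemma peq_bin: "s \<approx> s' \<Longrightarrow> t \<approx> t' \<Longrightarrow> RBin f s t \<approx> RBin f s' t'"
  unfolding peq_def by (blast intro: derivable.cong_bin eqv.cong_bin)

lemma peq_encap: "H \<subseteq> actions \<Longrightarrow> t \<approx> t' \<Longrightarrow> REncap H t \<approx> REncap H t'"
  unfolding peq_def by (blast intro: derivable.cong_encap eqv.cong_encap)

text \<open>Once the variables are replaced by recursion constants, a rewrite step is an axiom
  instance or an instance of \<open>RDP\<close>, inside a context. Well-formedness of
  \<open>v\<close> is carried along so that steps can be chained.\<close>

lemma rewrite_peq:
  assumes "guarded_spec E"
  shows "rewrite E V u v \<Longrightarrow> acp_term u \<Longrightarrow> acp_term v \<and> rec_inst E u \<approx> rec_inst E v"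
proof (induction rule: rewrite.induct)
  case (axiom_lr l r \<sigma>)
  have "inst (\<lambda>Y. rec_inst E (\<sigma> Y)) l \<approx> inst (\<lambda>Y. rec_inst E (\<sigma> Y)) r"
    using axiom_lr assms by (blast intro: peq_axiom acprec_term_rec_inst)
  then show ?case
    using axiom_lr by (auto simp: rec_inst_def inst_subst dest: acp_axiom_terms intro: acp_term_subst)
next
  case (axiom_rl l r \<sigma>)
  have "inst (\<lambda>Y. rec_inst E (\<sigma> Y)) l \<approx> inst (\<lambda>Y. rec_inst E (\<sigma> Y)) r"
    using axiom_rl assms by (blast intro: peq_axiom acprec_term_rec_inst)
  then show ?case
    using axiom_rl
    by (auto simp: rec_inst_def inst_subst dest: acp_axiom_terms intro: acp_term_subst peq_sym)
next
  case (unfold Y t)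
  have "rec_inst E (Var Y) = Rec Y E"
    using unfold by (auto simp: rec_inst_def)
  moreover have "acp_term t"
    using assms unfold unfolding guarded_spec_def by blast
  ultimately show ?case
    using assms unfold by (simp add: peq_RDP)
next
  case (bin_left s s' f t)
  then show ?case
    using acprec_term_rec_inst[OF assms, of t] by (auto simp: rec_inst_def intro: peq_bin peq_refl)
next
  case (bin_right t t' f s)
  then show ?case
    using acprec_term_rec_inst[OF assms, of s] by (auto simp: rec_inst_def intro: peq_bin peq_refl)
next
  case (encap t t' H)
  then show ?case
    by (auto simp: rec_inst_def intro: peq_encap)
qed

lemma rewrites_peq:
  assumes "guarded_spec E" "acp_term u" "(rewrite E V)\<^sup>*\<^sup>* u v"
  shows "acp_term v \<and> rec_inst E u \<approx> rec_inst E v"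
  using assms(3)
proof (induction rule: rtranclp_induct)
  case base
  then show ?case
    using assms by (blast intro: peq_refl acprec_term_rec_inst)
next
  case (step v w)
  then show ?case
    using rewrite_peq[OF assms(1)] peq_trans by blast
qed

subsection \<open>Head normal forms\<close>

inductive hnf :: "('a, 'x) acprec \<Rightarrow> bool" where
  const: "hnf (RConst a)"
| prefix: "closed_term s \<Longrightarrow> hnf (RBin Seq (RConst a) s)"
| alt: "hnf s \<Longrightarrow> hnf t \<Longrightarrow> hnf (RBin Alt s t)"

definition has_hnf :: "('a, 'x) acprec \<Rightarrow> bool" where
  "has_hnf s \<longleftrightarrow> (\<exists>h. hnf h \<and> s \<approx> h)"

lemma hnf_closed: "hnf h \<Longrightarrow> closed_term h"
  by (induction rule: hnf.induct) (auto simp: closed_term_def)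

lemma hnf_has_hnf: "hnf h \<Longrightarrow> has_hnf h"
  using hnf_closed peq_refl unfolding has_hnf_def closed_term_def by blast

lemma has_hnf_peq: "s \<approx> t \<Longrightarrow> has_hnf t \<Longrightarrow> has_hnf s"
  unfolding has_hnf_def using peq_trans by blast

lemma has_hnf_alt: "has_hnf s \<Longrightarrow> has_hnf t \<Longrightarrow> has_hnf (RBin Alt s t)"
  unfolding has_hnf_def by (blast intro: hnf.alt peq_bin)

section \<open>Finite sums as lists of heads\<close>

primrec summand :: "'a \<times> ('a, 'x) acprec option \<Rightarrow> ('a, 'x) acprec" where
  "summand (a, u) = (case u of None \<Rightarrow> RConst a | Some s \<Rightarrow> RBin Seq (RConst a) s)"

text \<open>The final \<open>\<delta>\<close> serves as the empty sum: it has no transitions, and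
  \<open>A6\<close> absorbs it.\<close>

primrec choice :: "('a \<times> ('a, 'x) acprec option) list \<Rightarrow> ('a, 'x) acprec" where
  "choice [] = RConst \<delta>"
| "choice (h # L) = RBin Alt (summand h) (choice L)"

text \<open>With \<open>\<delta>\<close> excluded as a head, every entry of \<open>L\<close> really
  is a transition of \<open>choice L\<close>.\<close>

definition head_list :: "('a \<times> ('a, 'x) acprec option) list \<Rightarrow> bool" where
  "head_list L \<longleftrightarrow> (\<forall>(a, u) \<in> set L. a \<in> actions \<and> (\<forall>s. u = Some s \<longrightarrow> closed_term s))"

lemma closed_choice: "head_list L \<Longrightarrow> closed_term (choice L)"
  by (induction L) (auto simp: head_list_def closed_term_def split: option.splits)

lemma term_step_choice: "term_step (choice L) a \<longleftrightarrow> a \<noteq> \<delta> \<and> (a, None) \<in> set L"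
  by (induction L) (auto split: option.splits)

lemma step_choice: "step (choice L) a s \<longleftrightarrow> a \<noteq> \<delta> \<and> (a, Some s) \<in> set L"
  by (induction L) (auto split: option.splits)

section \<open>Axiom instances for arbitrary terms\<close>

abbreviation asg :: "('a, 'x) acprec \<Rightarrow> ('a, 'x) acprec \<Rightarrow> ('a, 'x) acprec \<Rightarrow> 'x \<Rightarrow> ('a, 'x) acprec"
  where "asg p q r \<equiv> (\<lambda>v. if v = X then p else if v = Y then q else r)"

lemma distinct' [simp]: "Y \<noteq> X" "Z \<noteq> X" "Z \<noteq> Y"
  using distinct by metis+

lemma alt_commute:
  "acprec_term p \<Longrightarrow> acprec_term q \<Longrightarrow> RBin Alt p q \<approx> RBin Alt q p"
  using peq_axiom[OF A1[of X Y], of "asg p q q"] by simp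

lemma alt_assoc:
  "acprec_term p \<Longrightarrow> acprec_term q \<Longrightarrow> acprec_term r \<Longrightarrow>
    RBin Alt (RBin Alt p q) r \<approx> RBin Alt p (RBin Alt q r)"
  using peq_axiom[OF A2[of X Y Z], of "asg p q r"] by simp

lemma alt_idem: "acprec_term p \<Longrightarrow> RBin Alt p p \<approx> p"
  using peq_axiom[OF A3[of X], of "asg p p p"] by simp

lemma alt_seq:
  "acprec_term p \<Longrightarrow> acprec_term q \<Longrightarrow> acprec_term r \<Longrightarrow>
    RBin Seq (RBin Alt p q) r \<approx> RBin Alt (RBin Seq p r) (RBin Seq q r)"
  using peq_axiom[OF A4[of X Y Z], of "asg p q r"] by simp

lemma seq_assoc:
  "acprec_term p \<Longrightarrow> acprec_term q \<Longrightarrow> acprec_term r \<Longrightarrow>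
    RBin Seq (RBin Seq p q) r \<approx> RBin Seq p (RBin Seq q r)"
  using peq_axiom[OF A5[of X Y Z], of "asg p q r"] by simp

lemma alt_\<delta>: "acprec_term p \<Longrightarrow> RBin Alt p (RConst \<delta>) \<approx> p"
  using peq_axiom[OF A6[of X], of "asg p p p"] by simp

lemma \<delta>_seq: "acprec_term p \<Longrightarrow> RBin Seq (RConst \<delta>) p \<approx> RConst \<delta>"
  using peq_axiom[OF A7[of X], of "asg p p p"] by simp

lemma encap_const:
  "H \<subseteq> actions \<Longrightarrow> REncap H (RConst a) \<approx> RConst (if a \<in> H then \<delta> else a)"
  using peq_axiom[OF D1[of H a], of "\<lambda>_. RConst \<delta>"] peq_axiom[OF D2[of H a], of "\<lambda>_. RConst \<delta>"]
  by (cases "a \<in> H") auto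

lemma encap_alt:
  "H \<subseteq> actions \<Longrightarrow> acprec_term p \<Longrightarrow> acprec_term q \<Longrightarrow>
    REncap H (RBin Alt p q) \<approx> RBin Alt (REncap H p) (REncap H q)"
  using peq_axiom[OF D3[of H X Y], of "asg p q q"] by simp

lemma encap_seq:
  "H \<subseteq> actions \<Longrightarrow> acprec_term p \<Longrightarrow> acprec_term q \<Longrightarrow>
    REncap H (RBin Seq p q) \<approx> RBin Seq (REncap H p) (REncap H q)"
  using peq_axiom[OF D4[of H X Y], of "asg p q q"] by simp

lemma par_expand:
  "acprec_term p \<Longrightarrow> acprec_term q \<Longrightarrow>
    RBin Par p q \<approx> RBin Alt (RBin Alt (RBin LMerge p q) (RBin LMerge q p)) (RBin CMerge p q)"
  using peq_axiom[OF CM1[of X Y], of "asg p q q"] by simp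

lemma const_left_merge:
  "acprec_term p \<Longrightarrow> RBin LMerge (RConst a) p \<approx> RBin Seq (RConst a) p"
  using peq_axiom[OF CM2[of a X], of "asg p p p"] by simp

lemma prefix_left_merge:
  "acprec_term p \<Longrightarrow> acprec_term q \<Longrightarrow>
    RBin LMerge (RBin Seq (RConst a) p) q \<approx> RBin Seq (RConst a) (RBin Par p q)"
  using peq_axiom[OF CM3[of a X Y], of "asg p q q"] by simp

lemma alt_left_merge:
  "acprec_term p \<Longrightarrow> acprec_term q \<Longrightarrow> acprec_term r \<Longrightarrow>
    RBin LMerge (RBin Alt p q) r \<approx> RBin Alt (RBin LMerge p r) (RBin LMerge q r)"
  using peq_axiom[OF CM4[of X Y Z], of "asg p q r"] by simp

lemma const_comm_merge_const: "RBin CMerge (RConst a) (RConst b) \<approx> RConst (\<gamma> a b)"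
  using peq_axiom[OF CF[of a b], of "\<lambda>_. RConst \<delta>"] by simp

text \<open>\<open>CM5\<close> to \<open>CM7\<close> leave a communication of two constants in
  front; turning it into a single constant gives a prefix in the sense of
  \<open>hnf\<close>.\<close>

lemma const_comm_merge_seq:
  assumes "acprec_term p"
  shows "RBin Seq (RBin CMerge (RConst a) (RConst b)) p \<approx> RBin Seq (RConst (\<gamma> a b)) p"
  using assms by (intro peq_bin const_comm_merge_const peq_refl)

lemma prefix_comm_merge_const:
  "acprec_term p \<Longrightarrow>
    RBin CMerge (RBin Seq (RConst a) p) (RConst b) \<approx> RBin Seq (RConst (\<gamma> a b)) p"
  using peq_trans[OF _ const_comm_merge_seq] peq_axiom[OF CM5[of a X b], of "asg p p p"] by simp

lemma const_comm_merge_prefix: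
  "acprec_term p \<Longrightarrow>
    RBin CMerge (RConst a) (RBin Seq (RConst b) p) \<approx> RBin Seq (RConst (\<gamma> a b)) p"
  using peq_trans[OF _ const_comm_merge_seq] peq_axiom[OF CM6[of a b X], of "asg p p p"] by simp

lemma prefix_comm_merge_prefix:
  "acprec_term p \<Longrightarrow> acprec_term q \<Longrightarrow>
    RBin CMerge (RBin Seq (RConst a) p) (RBin Seq (RConst b) q) \<approx>
    RBin Seq (RConst (\<gamma> a b)) (RBin Par p q)"
  using peq_trans[OF _ const_comm_merge_seq] peq_axiom[OF CM7[of a X b Y], of "asg p q q"] by simp

lemma alt_comm_merge:
  "acprec_term p \<Longrightarrow> acprec_term q \<Longrightarrow> acprec_term r \<Longrightarrow>
    RBin CMerge (RBin Alt p q) r \<approx> RBin Alt (RBin CMerge p r) (RBin CMerge q r)"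
  using peq_axiom[OF CM8[of X Y Z], of "asg p q r"] by simp

lemma comm_merge_alt:
  "acprec_term p \<Longrightarrow> acprec_term q \<Longrightarrow> acprec_term r \<Longrightarrow>
    RBin CMerge p (RBin Alt q r) \<approx> RBin Alt (RBin CMerge p q) (RBin CMerge p r)"
  using peq_axiom[OF CM9[of X Y Z], of "asg p q r"] by simp

section \<open>Closure of head normal forms under the operators\<close>

lemma closed_imp_term: "closed_term t \<Longrightarrow> acprec_term t"
  by (simp add: closed_term_def)

lemma has_hnf_prefix: "closed_term s \<Longrightarrow> has_hnf (RBin Seq (RConst a) s)"
  by (blast intro: hnf_has_hnf hnf.prefix)

lemma closed_bin: "closed_term (RBin f s t) \<longleftrightarrow> closed_term s \<and> closed_term t"
  by (auto simp: closed_term_def)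

lemma has_hnf_seq:
  assumes "closed_term t"
  shows "hnf h \<Longrightarrow> has_hnf (RBin Seq h t)"
proof (induction rule: hnf.induct)
  case (const a)
  then show ?case using assms by (rule has_hnf_prefix)
next
  case (prefix s a)
  then show ?case
    using assms
    by (intro has_hnf_peq[OF seq_assoc] has_hnf_prefix) (auto simp: closed_bin closed_imp_term)
next
  case (alt s s')
  then show ?case
    using assms
    by (intro has_hnf_peq[OF alt_seq] has_hnf_alt) (auto dest: hnf_closed closed_imp_term)
qed

lemma has_hnf_encap:
  assumes "H \<subseteq> actions"
  shows "hnf h \<Longrightarrow> has_hnf (REncap H h)"
proof (induction rule: hnf.induct)
  case (const a)
  then show ?case
    using encap_const[OF assms] hnf.const unfolding has_hnf_def by blast
next
  case (prefix s a)
  let ?c = "if a \<in> H then \<delta> else a"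
  have "REncap H (RBin Seq (RConst a) s) \<approx> RBin Seq (REncap H (RConst a)) (REncap H s)"
    using prefix assms by (intro encap_seq) (auto simp: closed_imp_term)
  also have "\<dots> \<approx> RBin Seq (RConst ?c) (REncap H s)"
    using prefix assms by (intro peq_bin encap_const peq_refl) (auto simp: closed_imp_term)
  finally show ?case
    using has_hnf_peq has_hnf_prefix[of "REncap H s"] prefix assms
    by (auto simp: closed_term_def)
next
  case (alt s s')
  then show ?case
    using assms
    by (intro has_hnf_peq[OF encap_alt] has_hnf_alt) (auto dest: hnf_closed closed_imp_term)
qed

lemma has_hnf_left_merge:
  assumes "closed_term t"
  shows "hnf h \<Longrightarrow> has_hnf (RBin LMerge h t)"
proof (induction rule: hnf.induct)
  case (const a)
  then show ?case
    using assms by (intro has_hnf_peq[OF const_left_merge] has_hnf_prefix) (simp add: closed_imp_term)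
next
  case (prefix s a)
  then show ?case
    using assms
    by (intro has_hnf_peq[OF prefix_left_merge] has_hnf_prefix) (auto simp: closed_bin closed_imp_term)
next
  case (alt s s')
  then show ?case
    using assms
    by (intro has_hnf_peq[OF alt_left_merge] has_hnf_alt) (auto dest: hnf_closed closed_imp_term)
qed

text \<open>Nested inductions: \<open>CM8\<close> splits the left operand, then \<open>CM9\<close>
  the right one, until two single summands meet.\<close>

lemma has_hnf_comm_merge:
  assumes "hnf k"
  shows "hnf h \<Longrightarrow> has_hnf (RBin CMerge h k)"
proof (induction rule: hnf.induct)
  case (const a)
  show ?case
    using assms
  proof (induction rule: hnf.induct)
    case (const b)
    then show ?case
      using const_comm_merge_const hnf.const unfolding has_hnf_def by blast
  next
    case (prefix s b)
    then show ?case
      by (intro has_hnf_peq[OF const_comm_merge_prefix] has_hnf_prefix) (auto simp: closed_imp_term)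
  next
    case (alt s s')
    then show ?case
      by (intro has_hnf_peq[OF comm_merge_alt] has_hnf_alt) (auto dest: hnf_closed closed_imp_term)
  qed
next
  case (prefix s a)
  show ?case
    using assms
  proof (induction rule: hnf.induct)
    case (const b)
    then show ?case
      using prefix
      by (intro has_hnf_peq[OF prefix_comm_merge_const] has_hnf_prefix) (auto simp: closed_imp_term)
  next
    case (prefix s' b)
    then show ?case
      using \<open>closed_term s\<close>
      by (intro has_hnf_peq[OF prefix_comm_merge_prefix] has_hnf_prefix)
        (auto simp: closed_bin closed_imp_term)
  next
    case (alt s' s'')
    then show ?case
      using prefix
      by (intro has_hnf_peq[OF comm_merge_alt] has_hnf_alt) (auto dest: hnf_closed closed_imp_term)
  qed
next
  case (alt s s')
  then show ?case
    using assms
    by (intro has_hnf_peq[OF alt_comm_merge] has_hnf_alt) (auto dest: hnf_closed closed_imp_term)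
qed

text \<open>\<open>CM1\<close> reduces the merge to the left merge and the communication merge. This
  is not circular: the new parallel compositions which those create stand behind a prefix, where
  only closedness is demanded.\<close>

lemma has_hnf_bin:
  assumes "has_hnf s" "has_hnf t"
  shows "has_hnf (RBin f s t)"
proof -
  obtain h k where hk: "hnf h" "s \<approx> h" "hnf k" "t \<approx> k"
    using assms unfolding has_hnf_def by blast
  note closed = hnf_closed[OF hk(1)] hnf_closed[OF hk(3)]
  have "has_hnf (RBin f h k)"
  proof (cases f)
    case Par
    have "has_hnf (RBin Alt (RBin Alt (RBin LMerge h k) (RBin LMerge k h)) (RBin CMerge h k))"
      using hk closed by (intro has_hnf_alt has_hnf_left_merge has_hnf_comm_merge)
    then show ?thesis
      using has_hnf_peq[OF par_expand] closed Par by (simp add: closed_imp_term)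
  qed (use hk closed in \<open>simp_all add: hnf_has_hnf has_hnf_alt has_hnf_seq has_hnf_left_merge
        has_hnf_comm_merge\<close>)
  with peq_bin[OF hk(2,4)] show ?thesis
    by (rule has_hnf_peq)
qed

lemma has_hnf_encap':
  assumes "H \<subseteq> actions" "has_hnf t"
  shows "has_hnf (REncap H t)"
proof -
  obtain h where h: "hnf h" "t \<approx> h"
    using assms(2) unfolding has_hnf_def by blast
  then show ?thesis
    using has_hnf_peq[OF peq_encap[OF assms(1)]] has_hnf_encap[OF assms(1)] by blast
qed

text \<open>A prefix with an action is a head normal form whatever its tail; in every other compound
  term the operands are guarded again. A bare variable sits at the empty position and thus has no
  guard.\<close>

lemma guarded_has_hnf:
  assumes "guarded_spec E"
  shows "acp_term t \<Longrightarrow> vars t \<subseteq> dom E \<Longrightarrow> guarded t \<Longrightarrow> has_hnf (rec_inst E t)"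
proof (induction t)
  case (Var V)
  then show ?case
    unfolding guarded_def guarded_occ_def by (metis Nil_is_append_conv list.distinct(1) subterm_at.simps(1))
next
  case (Const a)
  then show ?case
    by (simp add: rec_inst_def hnf_has_hnf hnf.const)
next
  case (Bin f s t)
  show ?case
  proof (cases "\<exists>a\<in>actions. Bin f s t = Const a \<odot> t")
    case True
    moreover have "closed_term (rec_inst E t)"
      unfolding rec_inst_def
      using Bin.prems assms by (intro closed_inst) (auto simp: closed_term_def)
    ultimately show ?thesis
      using has_hnf_prefix by (auto simp: rec_inst_def)
  next
    case False
    then have "guarded s" "guarded t"
      using guarded_bin[OF Bin.prems(3)] by blast+
    then show ?thesis
      using Bin has_hnf_bin by (simp add: rec_inst_def)
  qed
next
  case (Encap H t)
  then show ?case
    using guarded_encap[OF Encap.prems(3)] has_hnf_encap' by (auto simp: rec_inst_def)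
qed

text \<open>A recursion constant is unfolded once by \<open>RDP\<close>; the rewriting to a guarded
  term that \<open>guarded_spec\<close> promises is then followed by provable equations.\<close>

lemma closed_has_hnf: "closed_term t \<Longrightarrow> has_hnf t"
proof (induction t)
  case (RConst a)
  then show ?case by (simp add: hnf_has_hnf hnf.const)
next
  case (Rec V E)
  then obtain t where E: "guarded_spec E" "E V = Some t"
    by (auto simp: closed_term_def)
  then obtain t' where t': "acp_term t" "(rewrite E V)\<^sup>*\<^sup>* t t'" "acp_term t'" "vars t' \<subseteq> dom E"
    "guarded t'"
    unfolding guarded_spec_def by blast
  have "Rec V E \<approx> rec_inst E t"
    using E by (rule peq_RDP)
  also have "\<dots> \<approx> rec_inst E t'"
    using rewrites_peq[OF E(1)] t' by blast
  finally show ?case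
    using has_hnf_peq guarded_has_hnf E t' by blast
qed (auto simp: closed_term_def has_hnf_bin has_hnf_encap')

section \<open>Sums are determined by their sets of heads\<close>

lemma choice_append:
  "acprec_term (choice L) \<Longrightarrow> acprec_term (choice L') \<Longrightarrow>
    RBin Alt (choice L) (choice L') \<approx> choice (L @ L')"
proof (induction L)
  case Nil
  then show ?case
    using peq_trans[OF alt_commute alt_\<delta>] by simp
next
  case (Cons h L)
  have "RBin Alt (choice (h # L)) (choice L') \<approx>
      RBin Alt (summand h) (RBin Alt (choice L) (choice L'))"
    using Cons.prems alt_assoc by simp
  also have "\<dots> \<approx> choice ((h # L) @ L')"
    using Cons by (simp add: peq_bin peq_refl)
  finally show ?case .
qed

text \<open>\<open>A7\<close> collapses a prefix with head \<open>\<delta>\<close>, and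
  \<open>A6\<close> supplies or removes the closing \<open>\<delta>\<close>.\<close>

lemma hnf_choice: "hnf h \<Longrightarrow> \<exists>L. h \<approx> choice L \<and> head_list L"
proof (induction rule: hnf.induct)
  case (const a)
  show ?case
  proof (cases "a = \<delta>")
    case True
    then show ?thesis
      by (intro exI[of _ "[]"]) (simp add: peq_refl head_list_def)
  next
    case False
    then show ?thesis
      by (intro exI[of _ "[(a, None)]"]) (simp add: alt_\<delta> peq_sym head_list_def)
  qed
next
  case (prefix s a)
  then have s: "acprec_term s"
    by (rule closed_imp_term)
  show ?case
  proof (cases "a = \<delta>")
    case True
    then show ?thesis
      using s by (intro exI[of _ "[]"]) (simp add: \<delta>_seq head_list_def)
  next
    case False
    then show ?thesis
      using s prefix by (intro exI[of _ "[(a, Some s)]"]) (simp add: alt_\<delta> peq_sym head_list_def)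
  qed
next
  case (alt s t)
  then obtain L L' where L: "s \<approx> choice L" "head_list L" "t \<approx> choice L'" "head_list L'"
    by blast
  then have "RBin Alt s t \<approx> choice (L @ L')"
    using choice_append peq_bin peq_trans peq_terms by metis
  then show ?case
    using L by (intro exI[of _ "L @ L'"]) (auto simp: head_list_def)
qed

text \<open>The additional summand is commuted along the sum until it meets its copy, where
  idempotence applies.\<close>

lemma choice_absorb:
  "h \<in> set L \<Longrightarrow> acprec_term (choice L) \<Longrightarrow> RBin Alt (summand h) (choice L) \<approx> choice L"
proof (induction L)
  case (Cons k L)
  let ?h = "summand h" and ?k = "summand k" and ?L = "choice L"
  have terms: "acprec_term ?k" "acprec_term ?L"
    using Cons.prems by auto
  show ?case
  proof (cases "h = k")
    case True
    have "RBin Alt ?h (RBin Alt ?k ?L) \<approx> RBin Alt (RBin Alt ?k ?k) ?L"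
      using True terms alt_assoc peq_sym by simp
    also have "\<dots> \<approx> RBin Alt ?k ?L"
      using terms by (simp add: peq_bin alt_idem peq_refl)
    finally show ?thesis by simp
  next
    case False
    then have IH: "RBin Alt ?h ?L \<approx> ?L"
      using Cons by simp
    \<comment> \<open>Both sides of a derivable equation are well-formed, so the induction
      hypothesis provides this.\<close>
    then have h: "acprec_term ?h"
      using peq_terms(1) by fastforce
    have "RBin Alt ?h (RBin Alt ?k ?L) \<approx> RBin Alt (RBin Alt ?h ?k) ?L"
      using h terms by (simp add: alt_assoc peq_sym)
    also have "\<dots> \<approx> RBin Alt (RBin Alt ?k ?h) ?L"
      using h terms by (simp add: alt_commute peq_bin peq_refl)
    also have "\<dots> \<approx> RBin Alt ?k (RBin Alt ?h ?L)"
      using h terms by (simp add: alt_assoc)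
    also have "\<dots> \<approx> RBin Alt ?k ?L"
      using IH terms by (simp add: peq_bin peq_refl)
    finally show ?thesis by simp
  qed
qed simp

lemma choice_subset:
  "set L \<subseteq> set L' \<Longrightarrow> acprec_term (choice L) \<Longrightarrow> acprec_term (choice L') \<Longrightarrow>
    RBin Alt (choice L) (choice L') \<approx> choice L'"
proof (induction L)
  case Nil
  then show ?case
    using peq_trans[OF alt_commute alt_\<delta>] by simp
next
  case (Cons h L)
  have "RBin Alt (choice (h # L)) (choice L') \<approx>
      RBin Alt (summand h) (RBin Alt (choice L) (choice L'))"
    using Cons.prems alt_assoc by simp
  also have "\<dots> \<approx> RBin Alt (summand h) (choice L')"
    using Cons by (simp add: peq_bin peq_refl)
  also have "\<dots> \<approx> choice L'"
    using Cons.prems choice_absorb by simp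
  finally show ?case .
qed

text \<open>Antisymmetry of the summand order: by \<open>choice_subset\<close> each sum absorbs the
  other. Order and multiplicity of heads therefore do not matter.\<close>

lemma choice_cong:
  assumes "set L = set L'" "acprec_term (choice L)" "acprec_term (choice L')"
  shows "choice L \<approx> choice L'"
proof -
  have "choice L \<approx> RBin Alt (choice L') (choice L)"
    using choice_subset assms peq_sym by blast
  also have "\<dots> \<approx> RBin Alt (choice L) (choice L')"
    using assms by (simp add: alt_commute)
  also have "\<dots> \<approx> choice L'"
    using choice_subset assms by blast
  finally show ?thesis .
qed

text \<open>Terminations match exactly, but continuations only up to \<open>eqv\<close>, since
  passing to a head normal form also changes the residuals.\<close>

definition expansion :: "('a, 'x) acprec \<Rightarrow> ('a \<times> ('a, 'x) acprec option) list \<Rightarrow> bool" where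
  "expansion t L \<longleftrightarrow> t \<approx> choice L \<and> head_list L \<and>
    (\<forall>a. term_step t a \<longleftrightarrow> (a, None) \<in> set L) \<and>
    (\<forall>a u. step t a u \<longrightarrow> (\<exists>v. (a, Some v) \<in> set L \<and> eqv u v)) \<and>
    (\<forall>a v. (a, Some v) \<in> set L \<longrightarrow> (\<exists>u. step t a u \<and> eqv v u))"

lemma ex_expansion:
  assumes "closed_term t"
  shows "\<exists>L. expansion t L"
proof -
  obtain L where L: "t \<approx> choice L" "head_list L"
    using closed_has_hnf[OF assms] hnf_choice peq_trans unfolding has_hnf_def by blast
  have action: "a \<noteq> \<delta>" if "(a, u) \<in> set L" for a u
    using L(2) that unfolding head_list_def by auto
  have eqv: "eqv t (choice L)"
    using L(1) unfolding peq_def by blast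
  have "term_step t a \<longleftrightarrow> (a, None) \<in> set L" for a
    using eqv_term_step[OF eqv] term_step_choice action by blast
  moreover have "\<exists>v. (a, Some v) \<in> set L \<and> eqv u v" if "step t a u" for a u
    using eqv_step[OF eqv that] step_choice by blast
  moreover have "\<exists>u. step t a u \<and> eqv v u" if "(a, Some v) \<in> set L" for a v
    using eqv_step[OF eqv.sym[OF eqv]] step_choice action that by blast
  ultimately show ?thesis
    using L unfolding expansion_def by blast
qed

subsection \<open>Linear specifications\<close>

text \<open>The open counterpart of \<open>choice\<close>, with variables as continuations; by
  \<open>inst_lin\<close> its instances are sums again.\<close>

primrec lin :: "('a \<times> 'x option) list \<Rightarrow> ('a, 'x) acp" where
  "lin [] = Const \<delta>"
| "lin (h # M) =
    (case snd h of None \<Rightarrow> Const (fst h) | Some V \<Rightarrow> Const (fst h) \<odot> Var V) \<oplus> lin M"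

lemma inst_lin: "inst \<sigma> (lin M) = choice (map (map_prod id (map_option \<sigma>)) M)"
  by (induction M) (auto split: option.splits)

lemma acp_term_lin: "acp_term (lin M)"
  by (induction M) (auto split: option.splits)

lemma vars_lin: "V \<in> vars (lin M) \<Longrightarrow> \<exists>a. (a, Some V) \<in> set M"
  by (induction M) (auto split: option.splits)

lemma guarded_const: "guarded (Const a)"
  unfolding guarded_def
proof (intro allI impI)
  show "guarded_occ (Const a) p" if "subterm_at p (Const a) = Some (Var V)" for p V
    using that by (cases p) auto
qed

lemma guarded_prefix:
  assumes "a \<in> actions"
  shows "guarded (Const a \<odot> t)"
  unfolding guarded_def
proof (intro allI impI)
  fix p V
  assume p: "subterm_at p (Const a \<odot> t) = Some (Var V)"
  then obtain i q where "p = i # q"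
    by (cases p) auto
  \<comment> \<open>The root is the guard: index 0 leads into a constant, which contains no
    variable.\<close>
  then have "p = [] @ 1 # q"
    using p by (cases q) (auto simp: less_Suc_eq split: if_splits)
  then show "guarded_occ (Const a \<odot> t) p"
    using assms unfolding guarded_occ_def by (metis subterm_at.simps(1))
qed

text \<open>The guard inside the summand remains one when the index of the summand is put in front
  of its position.\<close>

lemma guarded_alt:
  assumes "guarded s" "guarded t"
  shows "guarded (s \<oplus> t)"
  unfolding guarded_def
proof (intro allI impI)
  fix p V
  assume p: "subterm_at p (s \<oplus> t) = Some (Var V)"
  then obtain i q where iq: "p = i # q"
    by (cases p) auto
  then consider "i = 0" "subterm_at q s = Some (Var V)" | "i = 1" "subterm_at q t = Some (Var V)"
    using p by (auto simp: less_Suc_eq split: if_splits)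
  then obtain u where u: "guarded u" "subterm_at q u = Some (Var V)"
    "\<And>r. subterm_at (i # r) (s \<oplus> t) = subterm_at r u"
    using assms by cases auto
  then obtain q' r a t' where "q = q' @ 1 # r" "a \<in> actions" "subterm_at q' u = Some (Const a \<odot> t')"
    unfolding guarded_def guarded_occ_def by blast
  then show "guarded_occ (s \<oplus> t) p"
    unfolding guarded_occ_def using iq u(3)[of q'] by (metis append_Cons)
qed

lemma guarded_lin: "(\<And>a V. (a, V) \<in> set M \<Longrightarrow> a \<in> actions) \<Longrightarrow> guarded (lin M)"
proof (induction M)
  case (Cons h M)
  then show ?case
    by (cases h) (auto intro!: guarded_alt guarded_const guarded_prefix split: option.splits)
qed (simp add: guarded_const)

lemma head_list_cong: "set L = set L' \<Longrightarrow> head_list L \<Longrightarrow> head_list L'"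
  unfolding head_list_def by simp

section \<open>A common linear specification for two bisimilar terms\<close>

lemma bisimilar_derivable:
  fixes t t' :: "('a, 'x) acprec"
  assumes infinite: "infinite (UNIV :: 'x set)"
    and closed: "closed_term t" "closed_term t'"
    and "bisimilar t t'"
  shows "derivable t t'"
proof -
  obtain R where R: "bisimulation R" "R t t'"
    using assms(4) unfolding bisimilar_def by blast
  \<comment> \<open>This and the next two facts hold for every label, as labels of transitions are
    always actions.\<close>
  have R_term: "term_step u a \<longleftrightarrow> term_step u' a" if "R u u'" for u u' a
    using R(1) that term_step_action unfolding bisimulation_def by blast
  have R_step: "\<exists>v'. step u' a v' \<and> R v v'" if "R u u'" "step u a v" for u u' a v
    using R(1) that step_action unfolding bisimulation_def by blast
  have R_step': "\<exists>v. step u a v \<and> R v v'" if "R u u'" "step u' a v'" for u u' a v'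
    using R(1) that step_action unfolding bisimulation_def by blast

  \<comment> \<open>Expansions reproduce residuals only up to \<open>eqv\<close>, so
    \<open>R\<close> is closed under \<open>eqv\<close> on both sides.\<close>
  define Q where "Q s s' \<longleftrightarrow> (\<exists>u u'. eqv s u \<and> R u u' \<and> eqv u' s')" for s s'
  have Q_eqv: "Q s s'" if "eqv s u" "Q u u'" "eqv u' s'" for s s' u u'
    using that eqv.trans unfolding Q_def by blast
  have Q_term: "term_step s a \<longleftrightarrow> term_step s' a" if "Q s s'" for s s' a
    using that R_term eqv_term_step unfolding Q_def by blast
  have Q_step: "\<exists>v'. step s' a v' \<and> Q v v'" if "Q s s'" and v: "step s a v" for s s' a v
  proof -
    obtain u u' where u: "eqv s u" "R u u'" "eqv u' s'"
      using \<open>Q s s'\<close> unfolding Q_def by blast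
    obtain w where w: "step u a w" "eqv v w"
      using eqv_step[OF u(1) v] by blast
    obtain w' where w': "step u' a w'" "R w w'"
      using R_step[OF u(2) w(1)] by blast
    obtain v' where "step s' a v'" "eqv w' v'"
      using eqv_step[OF u(3) w'(1)] by blast
    then show ?thesis
      using w w' unfolding Q_def by blast
  qed
  have Q_step': "\<exists>v. step s a v \<and> Q v v'" if "Q s s'" and v': "step s' a v'" for s s' a v'
  proof -
    obtain u u' where u: "eqv s u" "R u u'" "eqv u' s'"
      using \<open>Q s s'\<close> unfolding Q_def by blast
    obtain w' where w': "step u' a w'" "eqv v' w'"
      using eqv_step[OF eqv.sym[OF u(3)] v'] by blast
    obtain w where w: "step u a w" "R w w'"
      using R_step'[OF u(2) w'(1)] by blast
    obtain v where "step s a v" "eqv w v"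
      using eqv_step[OF eqv.sym[OF u(1)] w(1)] by blast
    then show ?thesis
      using w w' eqv.sym unfolding Q_def by blast
  qed

  \<comment> \<open>One expansion is fixed for each closed term.\<close>
  obtain heads where "\<And>s. closed_term s \<Longrightarrow> expansion s (heads s)"
    using ex_expansion by metis
  then have heads:
    "\<And>s. closed_term s \<Longrightarrow> s \<approx> choice (heads s)"
    "\<And>s. closed_term s \<Longrightarrow> head_list (heads s)"
    "\<And>s a. closed_term s \<Longrightarrow> term_step s a \<longleftrightarrow> (a, None) \<in> set (heads s)"
    "\<And>s a u. closed_term s \<Longrightarrow> step s a u \<Longrightarrow> \<exists>v. (a, Some v) \<in> set (heads s) \<and> eqv u v"
    "\<And>s a v. closed_term s \<Longrightarrow> (a, Some v) \<in> set (heads s) \<Longrightarrow> \<exists>u. step s a u \<and> eqv v u"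
    unfolding expansion_def by simp_all
  have action: "a \<in> actions" if "closed_term s" "(a, u) \<in> set (heads s)" for s a u
    using heads(2)[OF that(1)] that(2) unfolding head_list_def by auto
  have closed_head: "closed_term v" if "closed_term s" "(a, Some v) \<in> set (heads s)" for s a v
    using heads(2)[OF that(1)] that(2) unfolding head_list_def by auto

  \<comment> \<open>\<open>eqv\<close> also relates open terms, for which \<open>heads\<close> is
    unspecified.\<close>
  define B where "B s s' \<longleftrightarrow> closed_term s \<and> closed_term s' \<and> Q s s'" for s s'
  have B_none: "(a, None) \<in> set (heads s) \<longleftrightarrow> (a, None) \<in> set (heads s')" if "B s s'" for s s' a
    using that Q_term heads(3) unfolding B_def by metis
  \<comment> \<open>The head becomes a transition of \<open>s\<close>, is matched by
    \<open>Q\<close>, and is read back as a head of \<open>s'\<close>; \<open>Q_eqv\<close> absorbs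
    both detours through \<open>eqv\<close>.\<close>
  have B_some: "\<exists>v'. (a, Some v') \<in> set (heads s') \<and> B v v'"
    if Bs: "B s s'" and v: "(a, Some v) \<in> set (heads s)" for s s' a v
  proof -
    have s: "closed_term s" "closed_term s'" "Q s s'"
      using Bs unfolding B_def by blast+
    obtain u where u: "step s a u" "eqv v u"
      using heads(5) s(1) v by blast
    obtain u' where u': "step s' a u'" "Q u u'"
      using Q_step s(3) u(1) by blast
    obtain v' where v': "(a, Some v') \<in> set (heads s')" "eqv u' v'"
      using heads(4) s(2) u'(1) by blast
    show ?thesis
      using Q_eqv u u' v v' closed_head s unfolding B_def by blast
  qed
  have B_some': "\<exists>v. (a, Some v) \<in> set (heads s) \<and> B v v'"
    if Bs: "B s s'" and v': "(a, Some v') \<in> set (heads s')" for s s' a v'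
  proof -
    have s: "closed_term s" "closed_term s'" "Q s s'"
      using Bs unfolding B_def by blast+
    obtain u' where u': "step s' a u'" "eqv v' u'"
      using heads(5) s(2) v' by blast
    obtain u where u: "step s a u" "Q u u'"
      using Q_step' s(3) u'(1) by blast
    obtain v where v: "(a, Some v) \<in> set (heads s)" "eqv u v"
      using heads(4) s(1) u(1) by blast
    show ?thesis
      using Q_eqv[OF _ u(2)] eqv.sym u' v v' closed_head s unfolding B_def by blast
  qed

  define succ where "succ = {((s, s'), (v, v')). B v v' \<and>
    (\<exists>a. (a, Some v) \<in> set (heads s) \<and> (a, Some v') \<in> set (heads s'))}"
  \<comment> \<open>Closed terms may outnumber the variables, so only these pairs receive an
    equation.\<close>
  define reach where "reach = succ\<^sup>* `` {(t, t')}"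
  have finite_succ: "finite (succ `` {p})" for p
  proof (cases p)
    case (Pair s s')
    \<comment> \<open>On terminating heads \<open>the\<close> has an unspecified value, which is
      harmless in an upper bound.\<close>
    have "succ `` {p} \<subseteq> (the \<circ> snd) ` set (heads s) \<times> (the \<circ> snd) ` set (heads s')"
      unfolding Pair succ_def by force
    then show ?thesis
      by (rule finite_subset) simp
  qed
  have "countable reach"
    unfolding reach_def
  proof (rule countable_rtrancl)
    fix P :: "(('a, 'x) acprec \<times> ('a, 'x) acprec) set"
    assume "countable P"
    moreover have "succ `` P = (\<Union>p\<in>P. succ `` {p})"
      by blast
    ultimately show "countable (succ `` P)"
      using finite_succ by (simp add: countable_finite)
  qed simp
  have start: "(t, t') \<in> reach"
    unfolding reach_def by blast
  have reach_succ: "(v, v') \<in> reach" if "(s, s') \<in> reach" "((s, s'), (v, v')) \<in> succ" for s s' v v'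
    using that unfolding reach_def by (auto intro: rtrancl_into_rtrancl)
  have reach_B: "B s s'" if "(s, s') \<in> reach" for s s'
  proof -
    have base: "B t t'"
      using closed R(2) eqv.refl unfolding B_def Q_def by blast
    have "((t, t'), (s, s')) \<in> succ\<^sup>*"
      using that unfolding reach_def by blast
    then show ?thesis
      by (cases rule: rtranclE) (use base in \<open>auto simp: succ_def\<close>)
  qed

  obtain f :: "nat \<Rightarrow> 'x" where "inj f"
    using infinite infinite_countable_subset by blast
  define var where "var = f \<circ> to_nat_on reach"
  have inj: "inj_on var reach"
    unfolding var_def using \<open>countable reach\<close> \<open>inj f\<close>
    by (intro comp_inj_on inj_on_to_nat_on) (auto intro: inj_on_subset)

  \<comment> \<open>The heads of the equation for \<open>(s, s')\<close>. A continuation of one side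
    may occur in several pairs; after projection these become copies of one head.\<close>
  define S where "S s s' = {(a, None) | a. (a, None) \<in> set (heads s)} \<union>
    {(a, Some (var (v, v'))) | a v v'.
      (a, Some v) \<in> set (heads s) \<and> (a, Some v') \<in> set (heads s') \<and> B v v'}" for s s'
  have finite_S: "finite (S s s')" for s s'
  proof -
    have "S s s' \<subseteq> fst ` set (heads s) \<times> insert None ((Some \<circ> var) ` (succ `` {(s, s')}))"
      unfolding S_def succ_def by force
    then show ?thesis
      by (rule finite_subset) (use finite_succ in simp)
  qed
  \<comment> \<open>An arbitrary enumeration of the finite set; its order is immaterial by
    \<open>choice_cong\<close>.\<close>
  obtain M where M: "\<And>s s'. set (M (s, s')) = S s s'"
  proof
    show "set ((\<lambda>(s, s'). SOME L. set L = S s s') (s, s')) = S s s'" for s s'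
      using someI_ex[OF finite_list[OF finite_S[of s s']]] by simp
  qed
  define E where "E V = (if V \<in> var ` reach then Some (lin (M (the_inv_into reach var V))) else None)" for V
  have dom_E: "dom E = var ` reach"
    unfolding E_def by (auto split: if_splits)
  have E_cases: "\<exists>s s'. (s, s') \<in> reach \<and> V = var (s, s') \<and> u = lin (M (s, s'))"
    if V: "E V = Some u" for V u
  proof -
    obtain s s' where s: "(s, s') \<in> reach" "V = var (s, s')"
      using V unfolding E_def by (auto split: if_splits)
    then show ?thesis
      using V the_inv_into_f_f[OF inj s(1)] unfolding E_def by auto
  qed
  have S_action: "a \<in> actions" if "(s, s') \<in> reach" "(a, V) \<in> S s s'" for s s' a V
    using that reach_B[OF that(1)] action unfolding S_def B_def by blast
  have S_var: "V \<in> var ` reach" if "(s, s') \<in> reach" "(a, Some V) \<in> S s s'" for s s' a V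
    using that reach_succ[OF that(1)] unfolding S_def succ_def by blast
  have "guarded_spec E"
    unfolding guarded_spec_def
  proof (intro allI impI)
    fix V u
    assume "E V = Some u"
    then obtain s s' where s: "(s, s') \<in> reach" "u = lin (M (s, s'))"
      using E_cases by blast
    have "vars u \<subseteq> dom E"
      using s vars_lin M S_var dom_E by fastforce
    moreover have "guarded u"
      unfolding s(2) using M S_action[OF s(1)] by (intro guarded_lin) auto
    \<comment> \<open>The right-hand side is guarded as it stands, so \<open>u'\<close> is
      \<open>u\<close>, reached in zero rewrite steps.\<close>
    ultimately show "acp_term u \<and> vars u \<subseteq> dom E \<and>
        (\<exists>u'. (rewrite E V)\<^sup>*\<^sup>* u u' \<and> acp_term u' \<and> vars u' \<subseteq> dom E \<and> guarded u')"
      using acp_term_lin s(2) by blast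
  qed

  \<comment> \<open>Stated for an arbitrary \<open>proj\<close> so that it serves for
    \<open>fst\<close> and for \<open>snd\<close>.\<close>
  have solution: "derivable (proj (t, t')) (Rec (var (t, t')) E)"
    if proj: "\<And>s s'. (s, s') \<in> reach \<Longrightarrow> closed_term (proj (s, s')) \<and>
      map_prod id (map_option (\<lambda>V. proj (the_inv_into reach var V))) ` S s s' =
        set (heads (proj (s, s')))"
    for proj
  proof -
    \<comment> \<open>\<open>RSP\<close> asks for a total assignment of well-formed terms;
      \<open>\<delta>\<close> is a default outside the specification.\<close>
    define \<sigma> where "\<sigma> V = (if V \<in> var ` reach then proj (the_inv_into reach var V) else RConst \<delta>)" for V
    have \<sigma>_var: "\<sigma> (var p) = proj p" if "p \<in> reach" for p
      using that the_inv_into_f_f[OF inj] unfolding \<sigma>_def by simp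
    have terms: "acprec_term (\<sigma> V)" for V
    proof (cases "V \<in> var ` reach")
      case True
      then obtain s s' where s: "(s, s') \<in> reach" "V = var (s, s')"
        by auto
      then show ?thesis
        using proj[OF s(1)] \<sigma>_var by (simp add: closed_imp_term)
    qed (simp add: \<sigma>_def)
    have "derivable (\<sigma> V) (inst \<sigma> u)" if V: "E V = Some u" for V u
    proof -
      obtain s s' where s: "(s, s') \<in> reach" "V = var (s, s')" "u = lin (M (s, s'))"
        using E_cases[OF V] by blast
      let ?L = "map (map_prod id (map_option \<sigma>)) (M (s, s'))"
      let ?p = "proj (s, s')"
      have p: "closed_term ?p"
        using proj[OF s(1)] by blast
      have "set ?L = map_prod id (map_option (\<lambda>V. proj (the_inv_into reach var V))) ` S s s'"
        unfolding set_map M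
      proof (rule image_cong)
        fix h
        assume "h \<in> S s s'"
        then show "map_prod id (map_option \<sigma>) h =
            map_prod id (map_option (\<lambda>V. proj (the_inv_into reach var V))) h"
          using S_var[OF s(1)] by (cases h; cases "snd h") (auto simp: \<sigma>_def)
      qed simp
      then have set_L: "set (heads ?p) = set ?L"
        using proj[OF s(1)] by simp
      have "?p \<approx> choice (heads ?p)"
        using heads(1) p by blast
      \<comment> \<open>The two lists agree only as sets.\<close>
      also have "\<dots> \<approx> choice ?L"
        using set_L head_list_cong[OF set_L] heads(2)[OF p]
        by (intro choice_cong closed_imp_term closed_choice) auto
      finally show ?thesis
        using s \<sigma>_var by (simp add: inst_lin peq_def)
    qed
    then have "derivable (\<sigma> (var (t, t'))) (Rec (var (t, t')) E)"
      using \<open>guarded_spec E\<close> terms start by (intro derivable.RSP) (auto simp: dom_E)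
    then show ?thesis
      using \<sigma>_var start by simp
  qed

  have inv_var: "the_inv_into reach var (var (v, v')) = (v, v')"
    if "(s, s') \<in> reach" "(a, Some v) \<in> set (heads s)" "(a, Some v') \<in> set (heads s')" "B v v'"
    for s s' a v v'
    using that reach_succ[OF that(1)] unfolding succ_def by (intro the_inv_into_f_f[OF inj]) blast
  have fst_S: "map_prod id (map_option (\<lambda>V. fst (the_inv_into reach var V))) ` S s s' = set (heads s)"
    (is "?f ` _ = _") if s: "(s, s') \<in> reach" for s s'
  proof (intro equalityI subsetI)
    fix h
    assume "h \<in> ?f ` S s s'"
    then show "h \<in> set (heads s)"
      unfolding S_def using inv_var[OF s] by auto
  next
    fix h
    assume h: "h \<in> set (heads s)"
    show "h \<in> ?f ` S s s'"
    proof (cases h)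
      case (Pair a w)
      show ?thesis
      proof (cases w)
        case None
        then have "h = ?f (a, None)" "(a, None) \<in> S s s'"
          using h Pair unfolding S_def by auto
        then show ?thesis by blast
      next
        case (Some v)
        \<comment> \<open>Bisimilarity enters here: without a partner \<open>v'\<close>, the head
          would be missing from \<open>S s s'\<close>.\<close>
        then obtain v' where v': "(a, Some v') \<in> set (heads s')" "B v v'"
          using B_some[OF reach_B[OF s]] h Pair by blast
        then have "h = ?f (a, Some (var (v, v')))" "(a, Some (var (v, v'))) \<in> S s s'"
          using h Pair Some inv_var[OF s] unfolding S_def by auto
        then show ?thesis by blast
      qed
    qed
  qed
  \<comment> \<open>Terminating heads in \<open>S\<close> are taken from \<open>s\<close>;
    \<open>B_none\<close> shows that \<open>s'\<close> has the same ones.\<close>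
  have snd_S: "map_prod id (map_option (\<lambda>V. snd (the_inv_into reach var V))) ` S s s' = set (heads s')"
    (is "?f ` _ = _") if s: "(s, s') \<in> reach" for s s'
  proof (intro equalityI subsetI)
    fix h
    assume "h \<in> ?f ` S s s'"
    then show "h \<in> set (heads s')"
      unfolding S_def using inv_var[OF s] B_none[OF reach_B[OF s]] by auto
  next
    fix h
    assume h: "h \<in> set (heads s')"
    show "h \<in> ?f ` S s s'"
    proof (cases h)
      case (Pair a w)
      show ?thesis
      proof (cases w)
        case None
        then have "h = ?f (a, None)" "(a, None) \<in> S s s'"
          using h Pair B_none[OF reach_B[OF s]] unfolding S_def by auto
        then show ?thesis by blast
      next
        case (Some v')
        then obtain v where v: "(a, Some v) \<in> set (heads s)" "B v v'"
          using B_some'[OF reach_B[OF s]] h Pair by blast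
        then have "h = ?f (a, Some (var (v, v')))" "(a, Some (var (v, v'))) \<in> S s s'"
          using h Pair Some inv_var[OF s] unfolding S_def by auto
        then show ?thesis by blast
      qed
    qed
  qed
  have fst_t: "derivable (fst (t, t')) (Rec (var (t, t')) E)"
  proof (rule solution, intro conjI)
    fix s s'
    assume s: "(s, s') \<in> reach"
    then show "closed_term (fst (s, s'))"
      using reach_B unfolding B_def by simp
    show "map_prod id (map_option (\<lambda>V. fst (the_inv_into reach var V))) ` S s s' =
        set (heads (fst (s, s')))"
      using fst_S[OF s] by simp
  qed
  have snd_t: "derivable (snd (t, t')) (Rec (var (t, t')) E)"
  proof (rule solution, intro conjI)
    fix s s'
    assume s: "(s, s') \<in> reach"
    then show "closed_term (snd (s, s'))"
      using reach_B unfolding B_def by simp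
    show "map_prod id (map_option (\<lambda>V. snd (the_inv_into reach var V))) ` S s s' =
        set (heads (snd (s, s')))"
      using snd_S[OF s] by simp
  qed
  show ?thesis
    using derivable.trans[OF fst_t derivable.sym[OF snd_t]] by simp
qed

end

end

theorem theorem3:
  fixes \<delta> :: 'a
    and \<gamma> :: "'a \<Rightarrow> 'a \<Rightarrow> 'a"
    and t t' :: "('a, 'x) acprec"
  assumes "ACP \<delta> \<gamma>"
    and "infinite (UNIV :: 'x set)"
    and "ACP.closed_term \<delta> \<gamma> t" and "ACP.closed_term \<delta> \<gamma> t'"
    and "ACP.bisimilar \<delta> \<gamma> t t'"
  shows "ACP.derivable \<delta> \<gamma> t t'"
proof -
  interpret ACP \<delta> \<gamma>
    by fact
  \<comment> \<open>Provides the three distinct variables used for instantiating the axioms.\<close>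
  have "\<exists>B :: 'x set. finite B \<and> card B = 3 \<and> B \<subseteq> UNIV"
    using assms(2) by (rule infinite_arbitrarily_large)
  then obtain X Y Z :: 'x where "X \<noteq> Y" "X \<noteq> Z" "Y \<noteq> Z"
    unfolding card_3_iff by metis
  then show ?thesis
    using assms(2-) by (rule bisimilar_derivable)
qed

end
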